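(* Let $\mathbf{S}$ be a schema, let $\mathcal{C}$ be a collection of $\mathbf{S}$-structures (closed under isomorphism), and let $n,m\geq 0$ with $n+m>0$ and $\ell>0$ be integers. The following are equivalent: (1) $\mathcal{C}$ is finitely axiomatizable by $(n,m,\ell)$-dexrs; (2) $\mathcal{C}$ is critical, closed under repairable direct products, and diagrammatically $(n,m,\ell)$-compatible.
   Context: Fix a countably infinite set $\mathbf{C}$ of constants and a disjoint set of variables. A schema $\mathbf{S}$ is a finite set of relation symbols, each with a positive arity $\mathrm{ar}(R)$. An $\mathbf{S}$-structure $I$ consists of a (finite or infinite) domain $\mathrm{dom}(I)\subseteq\mathbf{C}$ and a relation $R^I\subseteq\mathrm{dom}(I)^{\mathrm{ar}(R)}$ for each $R\in\mathbf{S}$. Its facts are the expressions $R(\bar c)$ with $\bar c\in R^I$, forming the set $\mathrm{facts}(I)$; its active domain $\mathrm{adom}(I)$ is the set of elements occurring in some fact. For $\mathbf{S}$-structures $I,J$: $J\subseteq I$ means $\mathrm{facts}(J)\subseteq\mathrm{facts}(I)$; $J\preceq I$ ($J$ is a substructure of $I$) means $\mathrm{dom}(J)\subseteq\mathrm{dom}(I)$ and $R^J=R^I\cap\mathrm{dom}(J)^{\mathrm{ar}(R)}$ for every $R\in\mathbf{S}$. Homomorphisms and isomorphisms are as usual; all collections of structures are assumed closed under isomorphism. A disjunctive existential rule (dexr) over $\mathbf{S}$ is a constant-free sentence $\forall\bar x\forall\bar y\,(\phi(\bar x,\bar y)\rightarrow\bigvee_{i=1}^k\exists\bar z_i\,\psi_i(\bar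 x_i,\bar z_i))$ where $k>0$, $\phi$ is a (possibly empty) conjunction of atoms over $\mathbf{S}$ (an atom is $R(\bar v)$ with $\bar v$ a tuple of variables), each $\psi_i$ is a non-empty conjunction of atoms over $\mathbf{S}$, the variables of $\bar x_i$ occur in $\bar x$, and each variable of $\bar x$ occurs in some $\bar x_i$; satisfaction is the usual first-order one (an empty body is read as true). It is an $(n,m,\ell)$-dexr if its body mentions at most $n$ (universally quantified) variables, each head disjunct has at most $m$ existentially quantified variables, and there are at most $\ell$ head disjuncts. $\mathcal{C}$ is finitely axiomatizable by a class of dexrs if there is a finite set $\Sigma$ of dexrs over $\mathbf{S}$ from that class such that for every $\mathbf{S}$-structure $I$: $I\in\mathcal{C}$ iff $I\models\Sigma$. Criticality: an $\mathbf{S}$-structure $I$ is $\kappa$-critical ($\kappa>0$) if $|\mathrm{dom}(I)|=\kappa$ and $R^I=\mathrm{dom}(I)^{\mathrm{ar}(R)}$ for all $R\in\mathbf{S}$; $\mathcal{C}$ is critical if for every $\kappa>0$ it contains a $\kappa$-critical structure. Repairable direct products: the direct product $I\otimes J$ has domain $\mathrm{dom}(I)\times\mathrm{dom}(J)$ and $((a_1,b_1),\dots,(a_r,b_r))\in R^{I\otimes J}$ iff $(a_1,\dots,a_r)\in R^I$ and $(b_1,\dots,b_r)\in R^J$. The projective homomorphism $\pi$ maps $(a,b)\mapsto a$. A repairable direct product of $I$ and $J$ is an $\mathbf{S}$-structure $L$ with $I\otimes J\subseteq L$ such that some extension of $\pi$ (to $\mathrm{dom}(L)$) is a homomorphism from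 $L$ to $I$. $\mathcal{C}$ is closed under repairable direct products if for all $I,J\in\mathcal{C}$ some repairable direct product of $I$ and $J$ lies in $\mathcal{C}$. Diagrams: sentences may mention constants from $\mathbf{C}$, interpreted as themselves (a structure $J$ satisfies such a sentence iff the expansion of $J$ with domain $\mathrm{dom}(J)$ together with the mentioned constants, each constant naming itself, satisfies it). Let $I$ be an $\mathbf{S}$-structure and $K\subseteq I$ a finite structure with $\mathrm{dom}(K)=\mathrm{adom}(K)$, and $m\geq 0$. With fixed distinct variables $y_1,\dots,y_m$, let $A_{K,m}$ be the set of atoms $R(\bar u)$ with $R\in\mathbf{S}$ and $\bar u\in(\mathrm{dom}(K)\cup\{y_1,\dots,y_m\})^{\mathrm{ar}(R)}$, $C_{K,m}$ the set of conjunctions of atoms from $A_{K,m}$, and $N^I_{K,m}=\{\gamma(\bar y)\in C_{K,m}: I\not\models\exists\bar y\,\gamma(\bar y)\}$. For $G\subseteq N^I_{K,m}$, the $G$-diagram of $K$ relative to $I$ is $\Delta^I_{K,G}=\bigwedge_{\alpha\in\mathrm{facts}(K)}\alpha\wedge\bigwedge_{c,d\in\mathrm{dom}(K),c\neq d}\neg(c=d)\wedge\bigwedge_{\gamma\in G}\neg\exists\bar y\,\gamma(\bar y)$ (empty conjunctions are true). An $(m,\ell)$-diagram of $K$ relative to $I$ is a $G$-diagram with $G\subseteq N^I_{K,m}$ and $|G|\leq\ell$. $\mathcal{C}$ is diagrammatically $(n,m,\ell)$-compatible with $I$ if for every $K\preceq I$ with $\mathrm{dom}(K)=\mathrm{adom}(K)$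 and $|\mathrm{dom}(K)|\leq n$, and every $(m,\ell)$-diagram $\Delta$ of $K$ relative to $I$, there is $J\in\mathcal{C}$ with $J\models\Delta$. $\mathcal{C}$ is diagrammatically $(n,m,\ell)$-compatible if every $\mathbf{S}$-structure $I$ with which $\mathcal{C}$ is diagrammatically $(n,m,\ell)$-compatible belongs to $\mathcal{C}$. *)

theory Defs
  imports Main "HOL-Library.Countable_Set"
begin

text \<open>Facts are atoms over constants, rule atoms are atoms over variables (natural numbers), and
  diagram atoms are atoms over terms. A conjunction of atoms is a list.\<close>

datatype (dead 'r, 't) atom = Atom 'r "'t list"

definition tuples :: "'a set \<Rightarrow> nat \<Rightarrow> 'a list set" where
  "tuples A k = {t. length t = k \<and> set t \<subseteq> A}"

definition schema :: "'r set \<Rightarrow> ('r \<Rightarrow> nat) \<Rightarrow> bool" where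
  "schema S ar \<longleftrightarrow> finite S \<and> (\<forall>R\<in>S. 0 < ar R)"

definition atom_over :: "'r set \<Rightarrow> ('r \<Rightarrow> nat) \<Rightarrow> 't set \<Rightarrow> ('r, 't) atom \<Rightarrow> bool" where
  "atom_over S ar T a \<longleftrightarrow> (\<exists>R\<in>S. \<exists>u\<in>tuples T (ar R). a = Atom R u)"


section \<open>Structures\<close>

record ('r, 'a) struct =
  domain :: "'a set"
  rel :: "'r \<Rightarrow> 'a list set"

text \<open>Symbols outside \<open>S\<close> are interpreted by the empty relation, so that a structure is determined
  by its domain and the interpretation of \<open>S\<close>; the notions below may then quantify over all symbols.
  The domain may be empty.\<close>

definition is_structure :: "'r set \<Rightarrow> ('r \<Rightarrow> nat) \<Rightarrow> ('r, 'a) struct \<Rightarrow> bool" where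
  "is_structure S ar I \<longleftrightarrow>
     (\<forall>R\<in>S. rel I R \<subseteq> tuples (domain I) (ar R)) \<and> (\<forall>R. R \<notin> S \<longrightarrow> rel I R = {})"

definition facts :: "('r, 'a) struct \<Rightarrow> ('r, 'a) atom set" where
  "facts I = {Atom R t | R t. t \<in> rel I R}"

definition adom :: "('r, 'a) struct \<Rightarrow> 'a set" where
  "adom I = (\<Union>a\<in>facts I. set_atom a)"

definition contained :: "('r, 'a) struct \<Rightarrow> ('r, 'a) struct \<Rightarrow> bool" where
  "contained J I \<longleftrightarrow> facts J \<subseteq> facts I"

definition substructure ::
  "'r set \<Rightarrow> ('r \<Rightarrow> nat) \<Rightarrow> ('r, 'a) struct \<Rightarrow> ('r, 'a) struct \<Rightarrow> bool" where
  "substructure S ar J I \<longleftrightarrow>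
     domain J \<subseteq> domain I \<and> (\<forall>R\<in>S. rel J R = rel I R \<inter> tuples (domain J) (ar R))"

definition homomorphism :: "('a \<Rightarrow> 'b) \<Rightarrow> ('r, 'a) struct \<Rightarrow> ('r, 'b) struct \<Rightarrow> bool" where
  "homomorphism h I J \<longleftrightarrow>
     h ` domain I \<subseteq> domain J \<and> (\<forall>R. \<forall>t\<in>rel I R. map h t \<in> rel J R)"

definition isomorphism :: "('a \<Rightarrow> 'b) \<Rightarrow> ('r, 'a) struct \<Rightarrow> ('r, 'b) struct \<Rightarrow> bool" where
  "isomorphism h I J \<longleftrightarrow>
     bij_betw h (domain I) (domain J) \<and>
     (\<forall>R t. set t \<subseteq> domain I \<longrightarrow> (t \<in> rel I R \<longleftrightarrow> map h t \<in> rel J R))"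

definition structure_collection ::
  "'r set \<Rightarrow> ('r \<Rightarrow> nat) \<Rightarrow> ('r, 'c) struct set \<Rightarrow> bool" where
  "structure_collection S ar \<C> \<longleftrightarrow>
     (\<forall>I\<in>\<C>. is_structure S ar I) \<and>
     (\<forall>I J h. I \<in> \<C> \<and> is_structure S ar J \<and> isomorphism h I J \<longrightarrow> J \<in> \<C>)"


section \<open>Disjunctive existential rules\<close>

text \<open>A rule is given by its body and the list of its head disjuncts. The quantifier prefixes are
  determined by these: the universally quantified variables are those of the body, and the
  existentially quantified variables of a disjunct are its variables not occurring in the body.\<close>

datatype 'r dexr = Dexr (body: "('r, nat) atom list") (heads: "('r, nat) atom list list")

definition vars :: "('r, nat) atom list \<Rightarrow> nat set" where
  "vars \<phi> = (\<Union>a\<in>set \<phi>. set_atom a)"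

definition exvars :: "'r dexr \<Rightarrow> ('r, nat) atom list \<Rightarrow> nat set" where
  "exvars \<sigma> \<psi> = vars \<psi> - vars (body \<sigma>)"

definition dexr_over :: "'r set \<Rightarrow> ('r \<Rightarrow> nat) \<Rightarrow> 'r dexr \<Rightarrow> bool" where
  "dexr_over S ar \<sigma> \<longleftrightarrow>
     (\<forall>a\<in>set (body \<sigma>). atom_over S ar UNIV a) \<and>
     heads \<sigma> \<noteq> [] \<and>
     (\<forall>\<psi>\<in>set (heads \<sigma>). \<psi> \<noteq> [] \<and> (\<forall>a\<in>set \<psi>. atom_over S ar UNIV a))"

definition nml_dexr :: "'r set \<Rightarrow> ('r \<Rightarrow> nat) \<Rightarrow> nat \<Rightarrow> nat \<Rightarrow> nat \<Rightarrow> 'r dexr \<Rightarrow> bool" where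
  "nml_dexr S ar n m l \<sigma> \<longleftrightarrow>
     dexr_over S ar \<sigma> \<and>
     card (vars (body \<sigma>)) \<le> n \<and>
     (\<forall>\<psi>\<in>set (heads \<sigma>). card (exvars \<sigma> \<psi>) \<le> m) \<and>
     length (heads \<sigma>) \<le> l"

definition sat_conj :: "('r, 'a) struct \<Rightarrow> ('t \<Rightarrow> 'a) \<Rightarrow> ('r, 't) atom list \<Rightarrow> bool" where
  "sat_conj I v \<phi> \<longleftrightarrow> (\<forall>a\<in>set \<phi>. map_atom v a \<in> facts I)"

definition sat_dexr :: "('r, 'a) struct \<Rightarrow> 'r dexr \<Rightarrow> bool" where
  "sat_dexr I \<sigma> \<longleftrightarrow>
     (\<forall>v. v ` vars (body \<sigma>) \<subseteq> domain I \<and> sat_conj I v (body \<sigma>) \<longrightarrow>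
        (\<exists>\<psi>\<in>set (heads \<sigma>). \<exists>w. (\<forall>x\<in>vars (body \<sigma>). w x = v x) \<and>
           w ` exvars \<sigma> \<psi> \<subseteq> domain I \<and> sat_conj I w \<psi>))"

definition finitely_axiomatizable ::
  "'r set \<Rightarrow> ('r \<Rightarrow> nat) \<Rightarrow> ('r dexr \<Rightarrow> bool) \<Rightarrow> ('r, 'c) struct set \<Rightarrow> bool" where
  "finitely_axiomatizable S ar P \<C> \<longleftrightarrow>
     (\<exists>\<Sigma>. finite \<Sigma> \<and> (\<forall>\<sigma>\<in>\<Sigma>. P \<sigma>) \<and>
        (\<forall>I. is_structure S ar I \<longrightarrow> (I \<in> \<C> \<longleftrightarrow> (\<forall>\<sigma>\<in>\<Sigma>. sat_dexr I \<sigma>))))"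


section \<open>Criticality and repairable direct products\<close>

definition critical_struct ::
  "'r set \<Rightarrow> ('r \<Rightarrow> nat) \<Rightarrow> nat \<Rightarrow> ('r, 'a) struct \<Rightarrow> bool" where
  "critical_struct S ar \<kappa> I \<longleftrightarrow>
     0 < \<kappa> \<and> is_structure S ar I \<and> card (domain I) = \<kappa> \<and>
     (\<forall>R\<in>S. rel I R = tuples (domain I) (ar R))"

definition critical :: "'r set \<Rightarrow> ('r \<Rightarrow> nat) \<Rightarrow> ('r, 'c) struct set \<Rightarrow> bool" where
  "critical S ar \<C> \<longleftrightarrow> (\<forall>\<kappa>>0. \<exists>I\<in>\<C>. critical_struct S ar \<kappa> I)"

definition direct_product ::
  "('r, 'a) struct \<Rightarrow> ('r, 'b) struct \<Rightarrow> ('r, 'a \<times> 'b) struct" where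
  "direct_product I J =
     \<lparr>domain = domain I \<times> domain J,
      rel = (\<lambda>R. {t. map fst t \<in> rel I R \<and> map snd t \<in> rel J R})\<rparr>"

text \<open>The elements of the direct product are pairs, whereas \<open>L\<close> lives on the constants, so \<open>L\<close>
  contains a copy \<open>P\<close> of the product along an isomorphism \<open>e\<close>. An extension of the projection to
  the domain of \<open>L\<close> presupposes that this domain includes that of the product.\<close>

definition repairable_direct_product ::
  "'r set \<Rightarrow> ('r \<Rightarrow> nat) \<Rightarrow>
   ('r, 'c) struct \<Rightarrow> ('r, 'c) struct \<Rightarrow> ('r, 'c) struct \<Rightarrow> bool" where
  "repairable_direct_product S ar I J L \<longleftrightarrow>
     is_structure S ar L \<and>
     (\<exists>P e. is_structure S ar P \<and> isomorphism e (direct_product I J) P \<and>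
        contained P L \<and> domain P \<subseteq> domain L \<and>
        (\<exists>h. homomorphism h L I \<and> (\<forall>p\<in>domain (direct_product I J). h (e p) = fst p)))"

definition closed_under_repairable_direct_products ::
  "'r set \<Rightarrow> ('r \<Rightarrow> nat) \<Rightarrow> ('r, 'c) struct set \<Rightarrow> bool" where
  "closed_under_repairable_direct_products S ar \<C> \<longleftrightarrow>
     (\<forall>I\<in>\<C>. \<forall>J\<in>\<C>. \<exists>L\<in>\<C>. repairable_direct_product S ar I J L)"


section \<open>Diagrams\<close>

text \<open>\<open>Y 0, \<dots>, Y (m - 1)\<close> are the distinguished variables. Sentences with constants are restricted
  to the shapes occurring in diagrams; \<open>ExY m \<gamma>\<close> quantifies all of \<open>Y 0, \<dots>, Y (m - 1)\<close>. A set of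
  sentences is read as their conjunction.\<close>

datatype 'c trm = Cst 'c | Y nat

datatype ('r, 'c) sentence =
    Fact "('r, 'c) atom"
  | Eq 'c 'c
  | ExY nat "('r, 'c trm) atom list"
  | Neg "('r, 'c) sentence"

primrec consts_of :: "('r, 'c) sentence \<Rightarrow> 'c set" where
  "consts_of (Fact a) = set_atom a"
| "consts_of (Eq c d) = {c, d}"
| "consts_of (ExY m \<gamma>) = {c. \<exists>a\<in>set \<gamma>. Cst c \<in> set_atom a}"
| "consts_of (Neg s) = consts_of s"

primrec eval_trm :: "(nat \<Rightarrow> 'c) \<Rightarrow> 'c trm \<Rightarrow> 'c" where
  "eval_trm w (Cst c) = c"
| "eval_trm w (Y i) = w i"

primrec holds :: "'c set \<Rightarrow> ('r, 'c) struct \<Rightarrow> ('r, 'c) sentence \<Rightarrow> bool" where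
  "holds D J (Fact a) \<longleftrightarrow> a \<in> facts J"
| "holds D J (Eq c d) \<longleftrightarrow> c = d"
| "holds D J (ExY m \<gamma>) \<longleftrightarrow> (\<exists>w. (\<forall>i<m. w i \<in> D) \<and> sat_conj J (eval_trm w) \<gamma>)"
| "holds D J (Neg s) \<longleftrightarrow> \<not> holds D J s"

text \<open>Quantifiers range over the domain extended by all constants mentioned in the sentence.\<close>

definition models :: "('r, 'c) struct \<Rightarrow> ('r, 'c) sentence set \<Rightarrow> bool" where
  "models J \<Delta> \<longleftrightarrow> (\<forall>s\<in>\<Delta>. holds (domain J \<union> (\<Union>s'\<in>\<Delta>. consts_of s')) J s)"

text \<open>As in the heads of rules, the conjunctions are non-empty. (The empty one could only be refuted
  by a structure with empty domain.)\<close>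

definition diagram_conjs ::
  "'r set \<Rightarrow> ('r \<Rightarrow> nat) \<Rightarrow> ('r, 'c) struct \<Rightarrow> nat \<Rightarrow> ('r, 'c trm) atom list set" where
  "diagram_conjs S ar K m =
     {\<gamma>. \<gamma> \<noteq> [] \<and> (\<forall>a\<in>set \<gamma>. atom_over S ar (Cst ` domain K \<union> Y ` {..<m}) a)}"

definition refuted_conjs ::
  "'r set \<Rightarrow> ('r \<Rightarrow> nat) \<Rightarrow> ('r, 'c) struct \<Rightarrow> ('r, 'c) struct \<Rightarrow> nat \<Rightarrow>
   ('r, 'c trm) atom list set" where
  "refuted_conjs S ar I K m = {\<gamma> \<in> diagram_conjs S ar K m. \<not> models I {ExY m \<gamma>}}"

definition diagram ::
  "nat \<Rightarrow> ('r, 'c) struct \<Rightarrow> ('r, 'c trm) atom list set \<Rightarrow> ('r, 'c) sentence set" where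
  "diagram m K G =
     Fact ` facts K \<union>
     {Neg (Eq c d) | c d. c \<in> domain K \<and> d \<in> domain K \<and> c \<noteq> d} \<union>
     (\<lambda>\<gamma>. Neg (ExY m \<gamma>)) ` G"

definition is_diagram ::
  "'r set \<Rightarrow> ('r \<Rightarrow> nat) \<Rightarrow> nat \<Rightarrow> nat \<Rightarrow> ('r, 'c) struct \<Rightarrow> ('r, 'c) struct \<Rightarrow>
   ('r, 'c) sentence set \<Rightarrow> bool" where
  "is_diagram S ar m l I K \<Delta> \<longleftrightarrow>
     (\<exists>G \<subseteq> refuted_conjs S ar I K m. finite G \<and> card G \<le> l \<and> \<Delta> = diagram m K G)"

definition diagram_compatible_with ::
  "'r set \<Rightarrow> ('r \<Rightarrow> nat) \<Rightarrow> nat \<Rightarrow> nat \<Rightarrow> nat \<Rightarrow>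
   ('r, 'c) struct set \<Rightarrow> ('r, 'c) struct \<Rightarrow> bool" where
  "diagram_compatible_with S ar n m l \<C> I \<longleftrightarrow>
     (\<forall>K \<Delta>. is_structure S ar K \<and> substructure S ar K I \<and> domain K = adom K \<and>
        finite (domain K) \<and> card (domain K) \<le> n \<and> is_diagram S ar m l I K \<Delta> \<longrightarrow>
        (\<exists>J\<in>\<C>. models J \<Delta>))"

definition diagram_compatible ::
  "'r set \<Rightarrow> ('r \<Rightarrow> nat) \<Rightarrow> nat \<Rightarrow> nat \<Rightarrow> nat \<Rightarrow> ('r, 'c) struct set \<Rightarrow> bool" where
  "diagram_compatible S ar n m l \<C> \<longleftrightarrow>
     (\<forall>I. is_structure S ar I \<and> diagram_compatible_with S ar n m l \<C> I \<longrightarrow> I \<in> \<C>)"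

end

theory Submission imports Defs begin

text \<open>Rules cannot separate a structure \<open>I\<close> from its blow-ups (elements replaced by classes of clones),
  and a blow-up of \<open>I\<close> contains the product of \<open>I\<close> with anything, so no chase is needed for
  repairable products. A violation of a rule by a valuation \<open>v\<close> is a diagram of the substructure on the
  values of \<open>v\<close>, which gives compatibility.

  Conversely, up to renaming and repetition there are only finitely many \<open>(n, m, l)\<close>-rules; take
  those valid in \<open>\<C>\<close>. If \<open>I\<close> satisfies them, a diagram of \<open>K\<close> relative to \<open>I\<close>, read as a rule, fails
  in \<open>I\<close> and hence in some \<open>J \<in> \<C>\<close>, though possibly through a non-injective valuation of \<open>K\<close>.
  A repaired product of \<open>J\<close> with a large critical structure makes the valuation injective.\<close>

section \<open>Satisfaction of conjunctions\<close>

lemma facts_Atom_iff [simp]: "Atom R t \<in> facts I \<longleftrightarrow> t \<in> rel I R"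
  by (auto simp: facts_def)

lemma contained_rel: "contained J I \<Longrightarrow> t \<in> rel J R \<Longrightarrow> t \<in> rel I R"
  unfolding contained_def by (drule subsetD[of _ _ "Atom R t"]) simp_all

lemma is_structureD: "is_structure S ar I \<Longrightarrow> t \<in> rel I R \<Longrightarrow> R \<in> S \<and> length t = ar R \<and> set t \<subseteq> domain I"
  unfolding is_structure_def tuples_def by blast

lemma set_atom_facts: "is_structure S ar I \<Longrightarrow> a \<in> facts I \<Longrightarrow> set_atom a \<subseteq> domain I"
  by (cases a) (auto dest: is_structureD)

lemma atom_over_fact:
  "is_structure S ar I \<Longrightarrow> a \<in> facts I \<Longrightarrow> atom_over S ar (domain I) a"
  by (cases a) (auto simp: atom_over_def tuples_def dest: is_structureD)

lemma atom_over_map: "atom_over S ar T a \<Longrightarrow> f ` T \<subseteq> T' \<Longrightarrow> atom_over S ar T' (map_atom f a)"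
  unfolding atom_over_def tuples_def by fastforce

lemma atom_over_mono: "atom_over S ar T a \<Longrightarrow> T \<subseteq> T' \<Longrightarrow> atom_over S ar T' a"
  unfolding atom_over_def tuples_def by fastforce

lemma set_atom_over: "atom_over S ar T a \<Longrightarrow> set_atom a \<subseteq> T"
  unfolding atom_over_def tuples_def by auto

text \<open>Positive arities enter here. An atom that holds in a structure therefore exhibits an
  element of its domain, which later serves as a default value.\<close>

lemma set_atom_over_nonempty: "schema S ar \<Longrightarrow> atom_over S ar T a \<Longrightarrow> set_atom a \<noteq> {}"
  unfolding atom_over_def tuples_def schema_def by fastforce

lemma finite_atom_over:
  assumes "schema S ar" "finite T"
  shows "finite {a. atom_over S ar T a}"
proof -
  have "{a. atom_over S ar T a} = (\<Union>R\<in>S. Atom R ` tuples T (ar R))"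
    by (auto simp: atom_over_def)
  moreover have "finite (tuples T k)" for k
    unfolding tuples_def using finite_lists_length_eq[OF assms(2)] by (simp add: conj_commute)
  ultimately show ?thesis using assms(1) by (simp add: schema_def)
qed

lemma finite_facts:
  assumes "schema S ar" "is_structure S ar I" "finite (domain I)"
  shows "finite (facts I)"
  by (rule finite_subset[OF _ finite_atom_over[OF assms(1,3)]]) (auto intro: atom_over_fact[OF assms(2)])

lemma sat_conj_map: "sat_conj I v (map (map_atom f) \<phi>) \<longleftrightarrow> sat_conj I (v \<circ> f) \<phi>"
  by (simp add: sat_conj_def atom.map_comp)

lemma sat_conj_remdups [simp]: "sat_conj I v (remdups \<phi>) \<longleftrightarrow> sat_conj I v \<phi>"
  by (simp add: sat_conj_def)

lemma sat_conj_cong: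
  assumes "\<And>a x. a \<in> set \<phi> \<Longrightarrow> x \<in> set_atom a \<Longrightarrow> v x = w x"
  shows "sat_conj I v \<phi> \<longleftrightarrow> sat_conj I w \<phi>"
  unfolding sat_conj_def by (rule ball_cong[OF refl]) (metis assms atom.map_cong0)

lemma sat_conj_hom:
  assumes "homomorphism h I J" "sat_conj I v \<phi>"
  shows "sat_conj J (h \<circ> v) \<phi>"
  unfolding sat_conj_def
proof
  fix a assume a: "a \<in> set \<phi>"
  obtain R t where at: "a = Atom R t" by (cases a)
  have "map v t \<in> rel I R" using assms(2) a by (force simp: sat_conj_def at)
  then have "map h (map v t) \<in> rel J R" using assms(1) unfolding homomorphism_def by blast
  then show "map_atom (h \<circ> v) a \<in> facts J" by (simp add: at)
qed

lemma sat_conj_domain: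
  assumes "is_structure S ar I" "sat_conj I v \<phi>" "a \<in> set \<phi>" "x \<in> set_atom a"
  shows "v x \<in> domain I"
proof -
  have "set_atom (map_atom v a) \<subseteq> domain I"
    using assms(1-3) by (intro set_atom_facts[OF assms(1)]) (simp add: sat_conj_def)
  then show ?thesis using assms(4) by (auto simp: atom.set_map)
qed

text \<open>Facts have all their entries in the domain, so a valuation satisfying a conjunction
  already sends its variables there. From here on rules are handled without domain
  conditions.\<close>

lemma sat_dexr_iff:
  assumes "is_structure S ar I"
  shows "sat_dexr I \<sigma> \<longleftrightarrow> (\<forall>v. sat_conj I v (body \<sigma>) \<longrightarrow>
    (\<exists>\<psi>\<in>set (heads \<sigma>). \<exists>w. (\<forall>x\<in>vars (body \<sigma>). w x = v x) \<and> sat_conj I w \<psi>))"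
proof -
  have dom: "v ` vars \<phi> \<subseteq> domain I" if "sat_conj I v \<phi>" for v \<phi>
    using sat_conj_domain[OF assms that] by (auto simp: vars_def)
  have "v ` vars \<phi> \<subseteq> domain I \<and> sat_conj I v \<phi> \<longleftrightarrow> sat_conj I v \<phi>" for v \<phi>
    using dom by blast
  moreover have "w ` exvars \<sigma> \<psi> \<subseteq> domain I \<and> sat_conj I w \<psi> \<longleftrightarrow> sat_conj I w \<psi>" for w \<psi>
    using dom[of w \<psi>] by (auto simp: exvars_def)
  ultimately show ?thesis unfolding sat_dexr_def by simp
qed

lemma vars_map_map_atom: "vars (map (map_atom f) \<phi>) = f ` (\<Union>a\<in>set \<phi>. set_atom a)"
  by (auto simp: vars_def atom.set_map)

lemma vars_remdups [simp]: "vars (remdups \<phi>) = vars \<phi>"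
  by (simp add: vars_def)

lemma finite_vars [simp]: "finite (vars \<phi>)"
proof -
  have "finite (set_atom a)" for a :: "('r, nat) atom" by (cases a) auto
  then show ?thesis by (simp add: vars_def)
qed

section \<open>Truth of diagrams, with quantifiers freed from their range\<close>

lemma holds_ExY_iff:
  assumes "schema S ar" "is_structure S ar J" "\<gamma> \<in> diagram_conjs S ar K m" "domain J \<subseteq> D"
  shows "holds D J (ExY m \<gamma>) \<longleftrightarrow> (\<exists>w. sat_conj J (eval_trm w) \<gamma>)"
proof
  assume "\<exists>w. sat_conj J (eval_trm w) \<gamma>"
  then obtain w where w: "sat_conj J (eval_trm w) \<gamma>" ..
  have "\<gamma> \<noteq> []" and over: "\<And>a. a \<in> set \<gamma> \<Longrightarrow> atom_over S ar (Cst ` domain K \<union> Y ` {..<m}) a"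
    using assms(3) by (auto simp: diagram_conjs_def)
  then obtain a where a: "a \<in> set \<gamma>" by (cases \<gamma>) auto
  then obtain x where "x \<in> set_atom a"
    using set_atom_over_nonempty[OF assms(1) over] by blast
  then have d: "eval_trm w x \<in> domain J" using sat_conj_domain[OF assms(2) w a] by blast
  \<comment> \<open>A variable \<open>Y i\<close> that does not occur in \<open>\<gamma>\<close> may
    have a value outside \<open>D\<close>. It is redirected to the value of a term that does occur,
    which exists because \<open>\<gamma>\<close> and its atoms are non-empty.\<close>
  define w' where "w' i = (if w i \<in> D then w i else eval_trm w x)" for i
  have "eval_trm w' y = eval_trm w y" if "b \<in> set \<gamma>" "y \<in> set_atom b" for b y
    using sat_conj_domain[OF assms(2) w that] assms(4) by (cases y) (auto simp: w'_def)
  then have "sat_conj J (eval_trm w') \<gamma>" using w sat_conj_cong by blast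
  moreover have "w' i \<in> D" for i using d assms(4) by (auto simp: w'_def)
  ultimately show "holds D J (ExY m \<gamma>)" by auto
qed auto

text \<open>Constants name themselves, so the inequalities of a diagram are true in every structure.
  What remains is that the facts of \<open>K\<close> hold literally, on the same constants, and that
  \<open>G\<close> is refuted.\<close>

lemma models_diagram_iff:
  assumes "schema S ar" "is_structure S ar J" "G \<subseteq> diagram_conjs S ar K m"
  shows "models J (diagram m K G) \<longleftrightarrow>
    facts K \<subseteq> facts J \<and> (\<forall>\<gamma>\<in>G. \<nexists>w. sat_conj J (eval_trm w) \<gamma>)"
proof -
  define D where "D = domain J \<union> (\<Union>s\<in>diagram m K G. consts_of s)"
  have "holds D J (ExY m \<gamma>) \<longleftrightarrow> (\<exists>w. sat_conj J (eval_trm w) \<gamma>)" if "\<gamma> \<in> G" for \<gamma>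
    using that assms by (intro holds_ExY_iff) (auto simp: D_def)
  moreover have "models J (diagram m K G) \<longleftrightarrow>
      facts K \<subseteq> facts J \<and> (\<forall>\<gamma>\<in>G. \<not> holds D J (ExY m \<gamma>))"
    unfolding models_def D_def[symmetric]
    by (auto simp: diagram_def ball_Un simp del: holds.simps(3))
  ultimately show ?thesis by blast
qed

lemma refuted_conjs_iff:
  assumes "schema S ar" "is_structure S ar I"
  shows "\<gamma> \<in> refuted_conjs S ar I K m \<longleftrightarrow>
    \<gamma> \<in> diagram_conjs S ar K m \<and> (\<nexists>w. sat_conj I (eval_trm w) \<gamma>)"
proof -
  have "models I {ExY m \<gamma>} \<longleftrightarrow> (\<exists>w. sat_conj I (eval_trm w) \<gamma>)"
    if "\<gamma> \<in> diagram_conjs S ar K m"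
    unfolding models_def using holds_ExY_iff[OF assms that, of "domain I \<union> consts_of (ExY m \<gamma>)"]
    by simp
  then show ?thesis by (auto simp: refuted_conjs_def)
qed


section \<open>Images and pullbacks of structures\<close>

definition map_struct :: "('a \<Rightarrow> 'b) \<Rightarrow> ('r, 'a) struct \<Rightarrow> ('r, 'b) struct" where
  "map_struct f I = \<lparr>domain = f ` domain I, rel = \<lambda>R. map f ` rel I R\<rparr>"

text \<open>This is the blow-up of \<open>I\<close>: each element is replaced by its fibre under
  \<open>h\<close>, and the members of a fibre are clones of one another.\<close>

definition pullback :: "('b \<Rightarrow> 'a) \<Rightarrow> ('r, 'a) struct \<Rightarrow> ('r, 'b) struct" where
  "pullback h I = \<lparr>domain = h -` domain I, rel = \<lambda>R. {t. map h t \<in> rel I R}\<rparr>"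

lemma is_structure_map_struct: "is_structure S ar I \<Longrightarrow> is_structure S ar (map_struct f I)"
  unfolding is_structure_def map_struct_def tuples_def by fastforce

lemma is_structure_pullback: "is_structure S ar I \<Longrightarrow> is_structure S ar (pullback h I)"
  unfolding is_structure_def pullback_def tuples_def by fastforce

lemma is_structure_direct_product:
  assumes "is_structure S ar I" "is_structure S ar J"
  shows "is_structure S ar (direct_product I J)"
  unfolding is_structure_def
proof (intro conjI ballI allI impI subsetI)
  fix R t assume t: "t \<in> rel (direct_product I J) R"
  then have "map fst t \<in> rel I R" "map snd t \<in> rel J R" by (auto simp: direct_product_def)
  from is_structureD[OF assms(1) this(1)] is_structureD[OF assms(2) this(2)]
  show "t \<in> tuples (domain (direct_product I J)) (ar R)"
    by (force simp: tuples_def direct_product_def)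
next
  fix R assume "R \<notin> S"
  then show "rel (direct_product I J) R = {}"
    using assms by (auto simp: direct_product_def is_structure_def)
qed

lemma isomorphism_map_struct:
  assumes "is_structure S ar I" "inj_on f (domain I)"
  shows "isomorphism f I (map_struct f I)"
  unfolding isomorphism_def
proof (intro conjI allI impI)
  show "bij_betw f (domain I) (domain (map_struct f I))"
    using assms(2) by (simp add: map_struct_def bij_betw_def)
  fix R t assume t: "set t \<subseteq> domain I"
  have "t \<in> rel I R" if "map f t \<in> map f ` rel I R"
  proof -
    from that obtain s where s: "s \<in> rel I R" "map f t = map f s" by auto
    then have "set s \<subseteq> domain I" using is_structureD[OF assms(1)] by blast
    with t have "inj_on f (set t \<union> set s)" by (intro inj_on_subset[OF assms(2)]) auto
    then have "t = s" using s(2) inj_on_map_eq_map by blast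
    then show ?thesis using s by simp
  qed
  then show "t \<in> rel I R \<longleftrightarrow> map f t \<in> rel (map_struct f I) R"
    by (auto simp: map_struct_def)
qed

lemma sat_conj_pullback: "sat_conj (pullback h I) v \<phi> \<longleftrightarrow> sat_conj I (h \<circ> v) \<phi>"
proof -
  have "map_atom v a \<in> facts (pullback h I) \<longleftrightarrow> map_atom (h \<circ> v) a \<in> facts I" for a
    by (cases a) (simp add: pullback_def)
  then show ?thesis by (simp add: sat_conj_def)
qed

text \<open>Composing with \<open>h\<close> turns a match of the body in the blow-up into one in
  \<open>I\<close>. The head witness found in \<open>I\<close> lifts back by choosing a clone of
  each value, since a conjunction in the blow-up sees only fibres.\<close>

lemma sat_dexr_pullback:
  assumes "is_structure S ar I" "surj h" "sat_dexr I \<sigma>"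
  shows "sat_dexr (pullback h I) \<sigma>"
  unfolding sat_dexr_iff[OF is_structure_pullback[OF assms(1)]] sat_conj_pullback
proof (intro allI impI)
  fix v assume "sat_conj I (h \<circ> v) (body \<sigma>)"
  then obtain \<psi> w where w: "\<psi> \<in> set (heads \<sigma>)" "\<forall>x\<in>vars (body \<sigma>). w x = (h \<circ> v) x"
      "sat_conj I w \<psi>"
    using assms(3) unfolding sat_dexr_iff[OF assms(1)] by blast
  \<comment> \<open>Body variables must keep the very clone given by \<open>v\<close>; the others
    take any preimage.\<close>
  define w' where "w' x = (if x \<in> vars (body \<sigma>) then v x else inv h (w x))" for x
  have "h \<circ> w' = w" using w(2) surj_f_inv_f[OF assms(2)] by (auto simp: w'_def)
  then show "\<exists>\<psi>\<in>set (heads \<sigma>). \<exists>w. (\<forall>x\<in>vars (body \<sigma>). w x = v x) \<and> sat_conj I (h \<circ> w) \<psi>"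
    using w by (intro bexI[of _ \<psi>] exI[of _ w']) (auto simp: w'_def)
qed


section \<open>From rules to closure properties\<close>

lemma infinite_UNIV_prod_bij:
  assumes "countable (UNIV :: 'c set)" "infinite (UNIV :: 'c set)"
  obtains e :: "'c \<times> 'c \<Rightarrow> 'c" where "bij e"
proof -
  obtain f :: "'c \<Rightarrow> nat" where f: "bij f" using countableE_infinite[OF assms] .
  then have "bij (map_prod f f)" by (simp add: bij_def prod.inj_map map_prod_surj)
  then have "bij (inv f \<circ> prod_encode \<circ> map_prod f f)"
    using f bij_prod_encode by (intro bij_comp bij_imp_bij_inv)
  then show thesis by (rule that)
qed

lemma critical_struct_exists:
  assumes "infinite (UNIV :: 'c set)" "\<kappa> > 0"
  obtains I :: "('r, 'c) struct" where "critical_struct S ar \<kappa> I"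
proof -
  obtain D :: "'c set" where D: "card D = \<kappa>"
    using infinite_arbitrarily_large[OF assms(1)] by blast
  define I :: "('r, 'c) struct" where
    "I = \<lparr>domain = D, rel = \<lambda>R. if R \<in> S then tuples D (ar R) else {}\<rparr>"
  show thesis
    by (rule that[of I]) (simp add: critical_struct_def is_structure_def I_def D assms)
qed

lemma critical_struct_sat_conj:
  assumes "critical_struct S ar \<kappa> I" "range v \<subseteq> domain I" "\<And>a. a \<in> set \<phi> \<Longrightarrow> atom_over S ar T a"
  shows "sat_conj I v \<phi>"
  unfolding sat_conj_def
proof
  fix a assume "a \<in> set \<phi>"
  from assms(3)[OF this] obtain R u where "R \<in> S" "length u = ar R" "a = Atom R u"
    by (auto simp: atom_over_def tuples_def)
  then show "map_atom v a \<in> facts I"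
    using assms(1,2) by (auto simp: critical_struct_def tuples_def)
qed

lemma critical_struct_sat_dexr:
  assumes "critical_struct S ar \<kappa> I" "dexr_over S ar \<sigma>"
  shows "sat_dexr I \<sigma>"
proof -
  have I: "is_structure S ar I" using assms(1) by (simp add: critical_struct_def)
  obtain d where d: "d \<in> domain I"
    using assms(1) unfolding critical_struct_def by fastforce
  obtain \<psi> where \<psi>: "\<psi> \<in> set (heads \<sigma>)"
    using assms(2) by (cases "heads \<sigma>") (auto simp: dexr_over_def)
  show ?thesis unfolding sat_dexr_iff[OF I]
  proof (intro allI impI)
    fix v assume v: "sat_conj I v (body \<sigma>)"
    \<comment> \<open>In a critical structure every tuple of elements is a fact, so any head
      disjunct holds once its existential variables are sent to a fixed element.\<close>
    define w where "w x = (if x \<in> vars (body \<sigma>) then v x else d)" for x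
    have "range w \<subseteq> domain I"
      using sat_conj_domain[OF I v] d by (auto simp: w_def vars_def)
    then have "sat_conj I w \<psi>"
      using assms \<psi> by (intro critical_struct_sat_conj[where T = UNIV]) (auto simp: dexr_over_def)
    then show "\<exists>\<psi>\<in>set (heads \<sigma>). \<exists>w. (\<forall>x\<in>vars (body \<sigma>). w x = v x) \<and> sat_conj I w \<psi>"
      using \<psi> by (intro bexI[of _ \<psi>] exI[of _ w]) (auto simp: w_def)
  qed
qed

text \<open>Reading each constant as a coded pair and blowing \<open>I\<close> up along the first
  coordinate amounts to dropping the condition that the product imposes through \<open>J\<close>.
  Hence the blow-up contains the product, and the first coordinate itself is the required
  homomorphism.\<close>

lemma repairable_direct_product_pullback:
  fixes I J :: "('r, 'c) struct" and e :: "'c \<times> 'c \<Rightarrow> 'c"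
  assumes "is_structure S ar I" "is_structure S ar J" "bij e"
  shows "repairable_direct_product S ar I J (pullback (fst \<circ> inv e) I)"
proof -
  have inv: "inv e (e p) = p" for p using assms(3) by (simp add: bij_is_inj)
  have comp: "fst \<circ> inv e \<circ> e = fst" by (simp add: fun_eq_iff inv)
  note prod = is_structure_direct_product[OF assms(1,2)]
  let ?P = "map_struct e (direct_product I J)" and ?L = "pullback (fst \<circ> inv e) I"
  have "isomorphism e (direct_product I J) ?P"
    using assms(3) by (intro isomorphism_map_struct[OF prod]) (auto simp: bij_def intro: inj_on_subset)
  moreover have "contained ?P ?L"
    by (auto simp: contained_def facts_def map_struct_def pullback_def direct_product_def comp)
  moreover have "domain ?P \<subseteq> domain ?L"
    by (auto simp: map_struct_def pullback_def direct_product_def inv)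
  moreover have "homomorphism (fst \<circ> inv e) ?L I"
    by (auto simp: homomorphism_def pullback_def)
  ultimately show ?thesis
    unfolding repairable_direct_product_def
    by (intro conjI exI[of _ ?P] exI[of _ e] exI[of _ "fst \<circ> inv e"])
      (auto simp: inv is_structure_pullback[OF assms(1)] is_structure_map_struct[OF prod])
qed

text \<open>If the rule fails in \<open>I\<close> at \<open>v\<close>, each head disjunct becomes a
  refuted conjunction once its body variables are replaced by their values. A model of the resulting
  diagram in \<open>\<C>\<close> satisfies the body under the same \<open>v\<close> but none of the
  heads, a contradiction.\<close>

lemma diagram_compatible_with_sat_dexr:
  assumes S: "schema S ar" and \<sigma>: "nml_dexr S ar n m l \<sigma>"
    and C: "\<And>J. J \<in> \<C> \<Longrightarrow> is_structure S ar J \<and> sat_dexr J \<sigma>"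
    and I: "is_structure S ar I" and compat: "diagram_compatible_with S ar n m l \<C> I"
  shows "sat_dexr I \<sigma>"
proof (rule ccontr)
  assume "\<not> sat_dexr I \<sigma>"
  then obtain v where v: "sat_conj I v (body \<sigma>)"
    and no: "\<And>\<psi> w. \<psi> \<in> set (heads \<sigma>) \<Longrightarrow> (\<forall>x\<in>vars (body \<sigma>). w x = v x) \<Longrightarrow> \<not> sat_conj I w \<psi>"
    unfolding sat_dexr_iff[OF I] by blast
  let ?B = "vars (body \<sigma>)"
  define D where "D = v ` ?B"
  \<comment> \<open>The substructure of \<open>I\<close> induced on the values of \<open>v\<close>.
    Every such value occurs in the image of a body atom, whence
    \<open>domain K = adom K\<close>.\<close>
  define K where "K = \<lparr>domain = D, rel = \<lambda>R. {t \<in> rel I R. set t \<subseteq> D}\<rparr>"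
  have D: "D \<subseteq> domain I" using sat_conj_domain[OF I v] by (auto simp: D_def vars_def)
  have K: "is_structure S ar K"
    using I by (auto simp: is_structure_def K_def tuples_def)
  have sub: "substructure S ar K I"
    using D by (auto simp: substructure_def K_def tuples_def dest: is_structureD[OF I])
  have vK: "map_atom v a \<in> facts K" if "a \<in> set (body \<sigma>)" for a
  proof (cases a)
    case (Atom R t)
    then have "v ` set t \<subseteq> D" using that by (force simp: D_def vars_def)
    then show ?thesis using v that Atom by (auto simp: sat_conj_def K_def)
  qed
  have "D \<subseteq> adom K"
    using vK by (force simp: D_def vars_def adom_def atom.set_map)
  moreover have "adom K \<subseteq> D"
    using set_atom_facts[OF K] by (auto simp: adom_def K_def)
  ultimately have adom: "domain K = adom K" by (simp add: K_def)
  have card: "finite (domain K)" "card (domain K) \<le> n"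
    using \<sigma> card_image_le[of ?B v] by (auto simp: K_def D_def nml_dexr_def)
  \<comment> \<open>The bound \<open>m\<close> on existential variables allows them to be renamed
    injectively, for each disjunct separately, to indices of the variables
    \<open>Y i\<close>.\<close>
  have "\<exists>f. inj_on f (exvars \<sigma> \<psi>) \<and> f ` exvars \<sigma> \<psi> \<subseteq> {..<m}" if "\<psi> \<in> set (heads \<sigma>)" for \<psi>
  proof -
    have "finite (exvars \<sigma> \<psi>)" "card (exvars \<sigma> \<psi>) \<le> card {..<m}"
      using \<sigma> that by (auto simp: exvars_def nml_dexr_def)
    then show ?thesis using inj_on_iff_card_le[of "exvars \<sigma> \<psi>" "{..<m}"] by auto
  qed
  then obtain f where inj: "\<And>\<psi>. \<psi> \<in> set (heads \<sigma>) \<Longrightarrow> inj_on (f \<psi>) (exvars \<sigma> \<psi>)"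
    and ran: "\<And>\<psi>. \<psi> \<in> set (heads \<sigma>) \<Longrightarrow> f \<psi> ` exvars \<sigma> \<psi> \<subseteq> {..<m}"
    by metis
  define \<tau> where "\<tau> \<psi> x = (if x \<in> ?B then Cst (v x) else Y (f \<psi> x))" for \<psi> x
  define g where "g \<psi> = map (map_atom (\<tau> \<psi>)) \<psi>" for \<psi>
  define G where "G = g ` set (heads \<sigma>)"
  have "g \<psi> \<in> refuted_conjs S ar I K m" if \<psi>: "\<psi> \<in> set (heads \<sigma>)" for \<psi>
  proof -
    have "atom_over S ar (Cst ` domain K \<union> Y ` {..<m}) (map_atom (\<tau> \<psi>) a)" if a: "a \<in> set \<psi>" for a
    proof -
      have "atom_over S ar UNIV a" using \<sigma> \<psi> a by (auto simp: nml_dexr_def dexr_over_def)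
      then have "atom_over S ar (vars \<psi>) a"
        using a by (force simp: atom_over_def tuples_def vars_def)
      moreover have "\<tau> \<psi> ` vars \<psi> \<subseteq> Cst ` domain K \<union> Y ` {..<m}"
        using ran[OF \<psi>] by (auto simp: \<tau>_def K_def D_def exvars_def)
      ultimately show ?thesis by (rule atom_over_map)
    qed
    moreover have "\<psi> \<noteq> []" using \<sigma> \<psi> by (auto simp: nml_dexr_def dexr_over_def)
    moreover have "\<not> sat_conj I (eval_trm w) (g \<psi>)" for w
      unfolding g_def sat_conj_map using no[OF \<psi>] by (simp add: \<tau>_def)
    ultimately show ?thesis
      by (auto simp: refuted_conjs_iff[OF S I] diagram_conjs_def g_def)
  qed
  then have G: "G \<subseteq> refuted_conjs S ar I K m" by (auto simp: G_def)
  moreover have "card G \<le> l"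
    using \<sigma> card_image_le[of "set (heads \<sigma>)" g] card_length[of "heads \<sigma>"]
    by (auto simp: G_def nml_dexr_def)
  ultimately have "is_diagram S ar m l I K (diagram m K G)"
    by (auto simp: is_diagram_def G_def)
  then obtain J where J: "J \<in> \<C>" "models J (diagram m K G)"
    using compat K sub adom card unfolding diagram_compatible_with_def by blast
  note Js = C[OF J(1), THEN conjunct1]
  have "G \<subseteq> diagram_conjs S ar K m" using G by (auto simp: refuted_conjs_def)
  from J(2)[unfolded models_diagram_iff[OF S Js this]]
  have KJ: "facts K \<subseteq> facts J" and refuted: "\<And>\<psi> w. \<psi> \<in> set (heads \<sigma>) \<Longrightarrow> \<not> sat_conj J (eval_trm w) (g \<psi>)"
    by (auto simp: G_def)
  have "sat_conj J v (body \<sigma>)" using vK KJ by (auto simp: sat_conj_def)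
  then obtain \<psi> w where \<psi>: "\<psi> \<in> set (heads \<sigma>)" and w: "\<forall>x\<in>?B. w x = v x" "sat_conj J w \<psi>"
    using C[OF J(1)] unfolding sat_dexr_iff[OF Js] by blast
  \<comment> \<open>The head witness \<open>w\<close> in \<open>J\<close> is carried to the
    variables \<open>Y i\<close> by undoing the renaming \<open>f \<psi>\<close>; this is where its
    injectivity matters.\<close>
  define w' where "w' = w \<circ> the_inv_into (exvars \<sigma> \<psi>) (f \<psi>)"
  have "(eval_trm w' \<circ> \<tau> \<psi>) x = w x" if "a \<in> set \<psi>" "x \<in> set_atom a" for a x
  proof (cases "x \<in> ?B")
    case False
    then have "x \<in> exvars \<sigma> \<psi>" using that by (auto simp: exvars_def vars_def)
    then show ?thesis using False the_inv_into_f_f[OF inj[OF \<psi>]] by (simp add: \<tau>_def w'_def)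
  qed (use w in \<open>auto simp: \<tau>_def\<close>)
  then have "sat_conj J (eval_trm w' \<circ> \<tau> \<psi>) \<psi>" using w(2) sat_conj_cong by blast
  then show False using refuted[OF \<psi>] by (simp add: g_def sat_conj_map)
qed


section \<open>From closure properties to rules\<close>

text \<open>Diagrams speak of particular constants, so a model found up to isomorphism has to be
  moved onto them by a permutation. Since \<open>A\<close> and its image have the same finite size,
  so do their complements in the union, and the partial inverse extends.\<close>

lemma bij_extending_inverse:
  assumes "finite A" "inj_on q A"
  obtains p :: "'a \<Rightarrow> 'a" where "bij p" "\<And>a. a \<in> A \<Longrightarrow> p (q a) = a"
proof -
  let ?F = "A \<union> q ` A"
  have "card (?F - q ` A) = card (?F - A)"
    using assms by (simp add: card_Diff_subset card_image)
  then obtain r where r: "bij_betw r (?F - q ` A) (?F - A)"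
    using assms(1) finite_same_card_bij[of "?F - q ` A" "?F - A"] by auto
  \<comment> \<open>Undo \<open>q\<close> on its image, match the leftover points of the union by
    \<open>r\<close>, and fix everything else.\<close>
  define p where "p x = (if x \<in> q ` A then the_inv_into A q x else if x \<in> A then r x else x)" for x
  have 1: "bij_betw p (q ` A) A"
    using bij_betw_the_inv_into[OF inj_on_imp_bij_betw[OF assms(2)]]
    by (rule bij_betw_cong[THEN iffD2, rotated]) (simp add: p_def)
  have 2: "bij_betw p (?F - q ` A) (?F - A)"
    using r by (rule bij_betw_cong[THEN iffD2, rotated]) (auto simp: p_def)
  have 3: "bij_betw p (- ?F) (- ?F)"
    using bij_betw_id[of "- ?F"] by (rule bij_betw_cong[THEN iffD2, rotated]) (auto simp: p_def)
  have "bij_betw p (q ` A \<union> (?F - q ` A)) (A \<union> (?F - A))"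
    using 1 2 by (rule bij_betw_combine) auto
  then have "bij_betw p (q ` A \<union> (?F - q ` A) \<union> (- ?F)) (A \<union> (?F - A) \<union> (- ?F))"
    using 3 by (rule bij_betw_combine) auto
  moreover have "q ` A \<union> (?F - q ` A) \<union> (- ?F) = UNIV" "A \<union> (?F - A) \<union> (- ?F) = UNIV" by auto
  ultimately have "bij p" by simp
  moreover have "p (q a) = a" if "a \<in> A" for a
    using that the_inv_into_f_f[OF assms(2)] by (simp add: p_def)
  ultimately show thesis by (rule that)
qed

text \<open>Multiplying with a critical structure as large as \<open>K\<close> separates the values of \<open>v\<close>, while the
  homomorphism back to \<open>J\<close> keeps the refuted conjunctions refuted.\<close>

lemma diagram_model_of_valuation:
  fixes \<C> :: "('r, 'c) struct set"
  assumes S: "schema S ar" and C: "structure_collection S ar \<C>"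
    and crit: "critical S ar \<C>" and closed: "closed_under_repairable_direct_products S ar \<C>"
    and K: "is_structure S ar K" "finite (domain K)"
    and J: "J \<in> \<C>" and vJ: "v ` domain K \<subseteq> domain J"
    and v: "\<And>a. a \<in> facts K \<Longrightarrow> map_atom v a \<in> facts J"
    and G: "G \<subseteq> diagram_conjs S ar K m" "\<And>\<gamma> w. \<gamma> \<in> G \<Longrightarrow> \<not> sat_conj J (case_trm v w) \<gamma>"
  shows "\<exists>L\<in>\<C>. models L (diagram m K G)"
proof -
  \<comment> \<open>The successor keeps the size positive when \<open>K\<close> is empty.\<close>
  obtain Q where Q: "Q \<in> \<C>" "critical_struct S ar (Suc (card (domain K))) Q"
    using crit by (auto simp: critical_def)
  then have "finite (domain Q)" "card (domain K) \<le> card (domain Q)"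
    by (auto simp: critical_struct_def intro: card_ge_0_finite)
  then obtain b where b: "inj_on b (domain K)" "b ` domain K \<subseteq> domain Q"
    using inj_on_iff_card_le[OF K(2)] by blast
  have str: "is_structure S ar M" if "M \<in> \<C>" for M
    using C that unfolding structure_collection_def by blast
  from closed J Q(1) obtain L where L: "L \<in> \<C>" and rdp: "repairable_direct_product S ar J Q L"
    unfolding closed_under_repairable_direct_products_def by blast
  from rdp obtain P e h where iso: "isomorphism e (direct_product J Q) P"
    and PL: "contained P L" and h: "homomorphism h L J"
      "\<And>p. p \<in> domain (direct_product J Q) \<Longrightarrow> h (e p) = fst p"
    unfolding repairable_direct_product_def by blast
  \<comment> \<open>The label \<open>b c\<close> separates elements of \<open>K\<close> on which
    \<open>v\<close> agrees, so \<open>q\<close> is injective although \<open>v\<close> need not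
    be.\<close>
  define q where "q c = e (v c, b c)" for c
  have pair: "(v c, b c) \<in> domain (direct_product J Q)" if "c \<in> domain K" for c
    using that vJ b by (auto simp: direct_product_def)
  have hq: "h (q c) = v c" if "c \<in> domain K" for c
    using h(2)[OF pair[OF that]] by (simp add: q_def)
  have "inj_on q (domain K)"
  proof (rule inj_onI)
    fix c d assume cd: "c \<in> domain K" "d \<in> domain K" "q c = q d"
    have "inj_on e (domain (direct_product J Q))" using iso by (simp add: isomorphism_def bij_betw_def)
    then have "(v c, b c) = (v d, b d)" using cd pair by (auto simp: q_def dest: inj_onD)
    then show "c = d" using cd b(1) by (auto dest: inj_onD)
  qed
  \<comment> \<open>Renaming by \<open>p\<close> makes each \<open>q c\<close> the constant
    \<open>c\<close> itself, so that the facts of \<open>K\<close> hold literally in the renamed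
    copy of \<open>L\<close>.\<close>
  then obtain p where p: "bij p" "\<And>c. c \<in> domain K \<Longrightarrow> p (q c) = c"
    using bij_extending_inverse[OF K(2)] by blast
  have inv: "inv p (p x) = x" for x using p(1) by (simp add: bij_is_inj)
  let ?M = "map_struct p L"
  have M: "is_structure S ar ?M" by (rule is_structure_map_struct[OF str[OF L]])
  have "inj_on p (domain L)" using p(1) by (auto simp: bij_def intro: inj_on_subset)
  then have "isomorphism p L ?M" by (rule isomorphism_map_struct[OF str[OF L]])
  then have MC: "?M \<in> \<C>" using C L M unfolding structure_collection_def by blast
  have "facts K \<subseteq> facts ?M"
  proof
    fix a assume a: "a \<in> facts K"
    obtain R t where at: "a = Atom R t" by (cases a)
    have tK: "R \<in> S" "length t = ar R" "set t \<subseteq> domain K"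
      using is_structureD[OF K(1)] a at by auto
    let ?t = "map (\<lambda>c. (v c, b c)) t"
    have "map v t \<in> rel J R" using v[OF a] at by simp
    moreover have "map b t \<in> rel Q R"
      using Q(2) tK b(2) by (auto simp: critical_struct_def tuples_def)
    ultimately have "?t \<in> rel (direct_product J Q) R" by (simp add: direct_product_def comp_def)
    moreover have "set ?t \<subseteq> domain (direct_product J Q)" using tK pair by auto
    ultimately have "map e ?t \<in> rel P R" using iso unfolding isomorphism_def by blast
    then have "map e ?t \<in> rel L R" by (rule contained_rel[OF PL])
    then have "map q t \<in> rel L R" by (simp add: q_def[abs_def] comp_def)
    moreover have "map p (map q t) = t" using tK p(2) by (simp add: map_idI subset_iff)
    ultimately have "t \<in> rel ?M R" by (auto simp: map_struct_def intro: rev_image_eqI)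
    then show "a \<in> facts ?M" by (simp add: at)
  qed
  moreover have "\<not> sat_conj ?M (eval_trm w) \<gamma>" if \<gamma>: "\<gamma> \<in> G" for \<gamma> w
  proof
    assume sat: "sat_conj ?M (eval_trm w) \<gamma>"
    \<comment> \<open>Undoing the renaming and then applying \<open>h\<close> takes each
      \<open>c\<close> in \<open>K\<close> back to \<open>v c\<close>, so a witness for
      \<open>\<gamma>\<close> in the copy would give one in \<open>J\<close>.\<close>
    have "homomorphism (inv p) ?M L"
      by (auto simp: homomorphism_def map_struct_def inv comp_def)
    from sat_conj_hom[OF h(1) sat_conj_hom[OF this sat]]
    have "sat_conj J (h \<circ> (inv p \<circ> eval_trm w)) \<gamma>" .
    moreover have "(h \<circ> (inv p \<circ> eval_trm w)) x = case_trm v (h \<circ> inv p \<circ> w) x"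
      if "a \<in> set \<gamma>" "x \<in> set_atom a" for a x
    proof (cases x)
      case (Cst c)
      then have "c \<in> domain K"
        using that set_atom_over[of S ar _ a] G(1) \<gamma> by (fastforce simp: diagram_conjs_def)
      then show ?thesis using inv[of "q c"] p(2) hq Cst by simp
    qed simp
    ultimately have "sat_conj J (case_trm v (h \<circ> inv p \<circ> w)) \<gamma>" using sat_conj_cong by blast
    then show False using G(2) \<gamma> by blast
  qed
  ultimately show ?thesis using MC models_diagram_iff[OF S M G(1)] by blast
qed

text \<open>Representatives of rules up to renaming and repeated atoms. Variables below
  \<open>N\<close> leave finitely many atoms, and distinctness leaves finitely many
  conjunctions.\<close>

definition bounded_dexrs :: "'r set \<Rightarrow> ('r \<Rightarrow> nat) \<Rightarrow> nat \<Rightarrow> nat \<Rightarrow> 'r dexr set" where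
  "bounded_dexrs S ar N l =
     (let B = {\<phi>. set \<phi> \<subseteq> {a. atom_over S ar {..<N} a} \<and> distinct \<phi>}
      in (\<lambda>(\<phi>, \<Psi>). Dexr \<phi> \<Psi>) ` (B \<times> {\<Psi>. set \<Psi> \<subseteq> B \<and> length \<Psi> \<le> l}))"

lemma finite_bounded_dexrs: "schema S ar \<Longrightarrow> finite (bounded_dexrs S ar N l)"
  unfolding bounded_dexrs_def Let_def
  by (intro finite_imageI finite_cartesian_product finite_lists_length_le finite_subset_distinct
      finite_atom_over) auto

text \<open>Read the facts of \<open>K\<close> as a body and the members of \<open>G\<close> as head
  disjuncts. The rule fails in \<open>I\<close> when each element of \<open>K\<close> is sent to
  itself, so it cannot be valid in \<open>\<C>\<close>; a counterexample in some \<open>J\<close> is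
  the desired valuation. A rule has at least one disjunct, hence the condition that \<open>G\<close>
  is non-empty.\<close>

lemma valuation_of_bounded_dexrs:
  assumes S: "schema S ar" and I: "is_structure S ar I"
    and sat: "\<And>\<sigma>. \<sigma> \<in> bounded_dexrs S ar (n + m) l \<Longrightarrow> nml_dexr S ar n m l \<sigma> \<Longrightarrow>
      \<forall>J\<in>\<C>. sat_dexr J \<sigma> \<Longrightarrow> sat_dexr I \<sigma>"
    and C: "\<And>J. J \<in> \<C> \<Longrightarrow> is_structure S ar J"
    and K: "is_structure S ar K" "facts K \<subseteq> facts I" "domain K = adom K"
      "finite (domain K)" "card (domain K) \<le> n"
    and G: "G \<subseteq> refuted_conjs S ar I K m" "finite G" "card G \<le> l" "G \<noteq> {}"
  obtains J v where "J \<in> \<C>" "\<And>a. a \<in> facts K \<Longrightarrow> map_atom v a \<in> facts J"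
    "\<And>\<gamma> w. \<gamma> \<in> G \<Longrightarrow> \<not> sat_conj J (case_trm v w) \<gamma>"
proof -
  obtain f where "bij_betw f (domain K) {0..<card (domain K)}"
    using ex_bij_betw_finite_nat[OF K(4)] by blast
  then have f: "inj_on f (domain K)" "f ` domain K \<subseteq> {..<n}" using K(5) by (auto simp: bij_betw_def)
  obtain \<phi> where \<phi>: "set \<phi> = facts K"
    using finite_list[OF finite_facts[OF S K(1,4)]] by blast
  obtain \<Gamma> where \<Gamma>: "set \<Gamma> = G" "distinct \<Gamma>" using finite_distinct_list[OF G(2)] by blast
  \<comment> \<open>Elements of \<open>K\<close> become variables below \<open>n\<close>, and
    \<open>Y i\<close> becomes \<open>n + i\<close>, so existential variables never collide with
    those of the body and all stay below \<open>n + m\<close>.\<close>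
  define \<tau> where "\<tau> = case_trm f (\<lambda>i. n + i)"
  define g where "g \<gamma> = remdups (map (map_atom \<tau>) \<gamma>)" for \<gamma> :: "('a, 'b trm) atom list"
  define \<sigma> where "\<sigma> = Dexr (remdups (map (map_atom f) \<phi>)) (map g \<Gamma>)"
  have body: "body \<sigma> = remdups (map (map_atom f) \<phi>)" and heads: "set (heads \<sigma>) = g ` G"
    "length (heads \<sigma>) = card G"
    using \<Gamma> by (auto simp: \<sigma>_def distinct_card[symmetric])
  \<comment> \<open>Because \<open>domain K = adom K\<close>, every constant of \<open>K\<close>
    turns into a body variable and is universally quantified in the heads.\<close>
  have vars_body: "vars (body \<sigma>) = f ` domain K"
    by (simp add: body vars_map_map_atom \<phi> K(3) adom_def)
  have G': "G \<subseteq> diagram_conjs S ar K m" using G(1) by (auto simp: refuted_conjs_def)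
  then have Gatoms: "\<gamma> \<noteq> []" "\<And>a. a \<in> set \<gamma> \<Longrightarrow> atom_over S ar (Cst ` domain K \<union> Y ` {..<m}) a"
    if "\<gamma> \<in> G" for \<gamma> using that by (auto simp: diagram_conjs_def)
  have body_over: "atom_over S ar {..<n + m} a" if "a \<in> set (body \<sigma>)" for a
    using that atom_over_fact[OF K(1)] f(2) by (auto simp: body \<phi> intro!: atom_over_map)
  have head_over: "atom_over S ar (f ` domain K \<union> {n..<n + m}) a" if "\<gamma> \<in> G" "a \<in> set (g \<gamma>)" for \<gamma> a
  proof -
    from that obtain a' where a': "a' \<in> set \<gamma>" "a = map_atom \<tau> a'" by (auto simp: g_def)
    have "\<tau> ` (Cst ` domain K \<union> Y ` {..<m}) \<subseteq> f ` domain K \<union> {n..<n + m}"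
      by (auto simp: \<tau>_def)
    then show ?thesis unfolding a'(2) by (rule atom_over_map[OF Gatoms(2)[OF that(1) a'(1)]])
  qed
  have head_over': "atom_over S ar {..<n + m} a" if "\<gamma> \<in> G" "a \<in> set (g \<gamma>)" for \<gamma> a
    using f(2) by (intro atom_over_mono[OF head_over[OF that]]) auto
  have "g \<gamma> \<noteq> []" if "\<gamma> \<in> G" for \<gamma> using Gatoms(1)[OF that] by (simp add: g_def)
  moreover have "heads \<sigma> \<noteq> []" using heads(1) G(4) by auto
  ultimately have "dexr_over S ar \<sigma>"
    using atom_over_mono[OF body_over subset_UNIV] atom_over_mono[OF head_over' subset_UNIV]
    by (simp add: dexr_over_def heads(1))
  moreover have "card (exvars \<sigma> (g \<gamma>)) \<le> m" if "\<gamma> \<in> G" for \<gamma>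
  proof -
    have "exvars \<sigma> (g \<gamma>) \<subseteq> {n..<n + m}"
      using set_atom_over[OF head_over[OF that]] by (auto simp: exvars_def vars_body vars_def[of "g \<gamma>"])
    then show ?thesis using card_mono[of "{n..<n + m}"] by fastforce
  qed
  ultimately have nml: "nml_dexr S ar n m l \<sigma>"
    using K(5) card_image_le[OF K(4), of f] heads G(3) by (auto simp: nml_dexr_def vars_body)
  have "(body \<sigma>, heads \<sigma>) \<in> {\<phi>. set \<phi> \<subseteq> {a. atom_over S ar {..<n + m} a} \<and> distinct \<phi>} \<times>
      {\<Psi>. set \<Psi> \<subseteq> {\<phi>. set \<phi> \<subseteq> {a. atom_over S ar {..<n + m} a} \<and> distinct \<phi>} \<and> length \<Psi> \<le> l}"
    using body_over head_over' heads G(3) by (auto simp: body g_def)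
  then have bounded: "\<sigma> \<in> bounded_dexrs S ar (n + m) l"
    unfolding bounded_dexrs_def Let_def by (rule rev_image_eqI) simp
  have "\<not> sat_dexr I \<sigma>"
  proof
    assume "sat_dexr I \<sigma>"
    \<comment> \<open>Under this valuation the body is just the set of facts of \<open>K\<close>,
      which hold in \<open>I\<close>.\<close>
    define v where "v = the_inv_into (domain K) f"
    have vf: "v (f c) = c" if "c \<in> domain K" for c
      using that the_inv_into_f_f[OF f(1)] by (simp add: v_def)
    have "map_atom (v \<circ> f) a = a" if "a \<in> facts K" for a
      using set_atom_facts[OF K(1) that] vf
      by (metis (no_types, lifting) atom.map_cong0 atom.map_ident comp_apply subsetD)
    then have "sat_conj I v (body \<sigma>)"
      using K(2) by (auto simp: body sat_conj_map) (auto simp: sat_conj_def \<phi>)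
    then obtain \<gamma> w where \<gamma>: "\<gamma> \<in> G" and w: "\<forall>x\<in>vars (body \<sigma>). w x = v x" "sat_conj I w (g \<gamma>)"
      using \<open>sat_dexr I \<sigma>\<close> heads unfolding sat_dexr_iff[OF I] by auto
    have "(w \<circ> \<tau>) x = eval_trm (\<lambda>i. w (n + i)) x" if "a \<in> set \<gamma>" "x \<in> set_atom a" for a x
    proof (cases x)
      case (Cst c)
      then have "c \<in> domain K"
        using that set_atom_over[OF Gatoms(2)[OF \<gamma> that(1)]] by auto
      then show ?thesis using w(1) vf by (simp add: Cst \<tau>_def vars_body)
    qed (simp add: \<tau>_def)
    then have "sat_conj I (eval_trm (\<lambda>i. w (n + i))) \<gamma>"
      using w(2) sat_conj_cong[of \<gamma> "w \<circ> \<tau>"] by (simp add: g_def sat_conj_map)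
    then show False using \<gamma> G(1) refuted_conjs_iff[OF S I] by blast
  qed
  then obtain J where J: "J \<in> \<C>" "\<not> sat_dexr J \<sigma>" using sat[OF bounded nml] by blast
  from J(2) obtain u where u: "sat_conj J u (body \<sigma>)"
    and no: "\<And>\<psi> w. \<psi> \<in> set (heads \<sigma>) \<Longrightarrow> (\<forall>x\<in>vars (body \<sigma>). w x = u x) \<Longrightarrow> \<not> sat_conj J w \<psi>"
    unfolding sat_dexr_iff[OF C[OF J(1)]] by blast
  show thesis
  proof (rule that[OF J(1), of "u \<circ> f"])
    fix a assume "a \<in> facts K"
    then show "map_atom (u \<circ> f) a \<in> facts J"
      using u by (auto simp: body sat_conj_map) (auto simp: sat_conj_def \<phi>)
  next
    fix \<gamma> w assume \<gamma>: "\<gamma> \<in> G"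
    show "\<not> sat_conj J (case_trm (u \<circ> f) w) \<gamma>"
    proof
      assume s: "sat_conj J (case_trm (u \<circ> f) w) \<gamma>"
      \<comment> \<open>The two blocks of variables are glued: below \<open>n\<close> the
        counterexample \<open>u\<close>, from \<open>n\<close> on the values of the variables
        \<open>Y i\<close>.\<close>
      define w' where "w' x = (if x < n then u x else w (x - n))" for x
      have "(w' \<circ> \<tau>) x = case_trm (u \<circ> f) w x" if "a \<in> set \<gamma>" "x \<in> set_atom a" for a x
      proof (cases x)
        case (Cst c)
        then have "f c < n"
          using that set_atom_over[OF Gatoms(2)[OF \<gamma> that(1)]] f(2) by auto
        then show ?thesis by (simp add: Cst \<tau>_def w'_def)
      qed (simp add: \<tau>_def w'_def)
      then have "sat_conj J w' (g \<gamma>)"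
        using s sat_conj_cong[of \<gamma> "w' \<circ> \<tau>"] by (simp add: g_def sat_conj_map)
      moreover have "\<forall>x\<in>vars (body \<sigma>). w' x = u x" using f(2) by (auto simp: vars_body w'_def)
      ultimately show False using no \<gamma> heads by blast
    qed
  qed
qed

section \<open>The equivalence of axiomatizability and the closure properties\<close>

theorem theorem1:
  fixes S :: "'r set" and ar :: "'r \<Rightarrow> nat"
    and \<C> :: "('r, 'c) struct set"
    and n m l :: nat
  assumes "countable (UNIV :: 'c set)" and "infinite (UNIV :: 'c set)"
    and "schema S ar"
    and "structure_collection S ar \<C>"
    and "n + m > 0" and "l > 0"
  shows "finitely_axiomatizable S ar (nml_dexr S ar n m l) \<C> \<longleftrightarrow>
    critical S ar \<C> \<and>
    closed_under_repairable_direct_products S ar \<C> \<and>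
    diagram_compatible S ar n m l \<C>"
proof
  have str: "is_structure S ar J" if "J \<in> \<C>" for J
    using assms(4) that unfolding structure_collection_def by blast
  {
    assume "finitely_axiomatizable S ar (nml_dexr S ar n m l) \<C>"
    then obtain \<Sigma> where nml: "\<And>\<sigma>. \<sigma> \<in> \<Sigma> \<Longrightarrow> nml_dexr S ar n m l \<sigma>"
      and ax: "\<And>I. is_structure S ar I \<Longrightarrow> I \<in> \<C> \<longleftrightarrow> (\<forall>\<sigma>\<in>\<Sigma>. sat_dexr I \<sigma>)"
      unfolding finitely_axiomatizable_def by blast
    have "critical S ar \<C>"
      unfolding critical_def
    proof (intro allI impI)
      fix \<kappa> :: nat assume "\<kappa> > 0"
      then obtain I :: "('r, 'c) struct" where I: "critical_struct S ar \<kappa> I"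
        using critical_struct_exists[OF assms(2)] by blast
      then have "I \<in> \<C>"
        using ax[of I] nml critical_struct_sat_dexr[OF I]
        by (auto simp: nml_dexr_def critical_struct_def)
      with I show "\<exists>I\<in>\<C>. critical_struct S ar \<kappa> I" by blast
    qed
    moreover have "closed_under_repairable_direct_products S ar \<C>"
      unfolding closed_under_repairable_direct_products_def
    proof (intro ballI)
      fix I J assume IJ: "I \<in> \<C>" "J \<in> \<C>"
      obtain e :: "'c \<times> 'c \<Rightarrow> 'c" where e: "bij e"
        using infinite_UNIV_prod_bij[OF assms(1,2)] .
      \<comment> \<open>Each constant is read as a pair through \<open>e\<close>, and
        \<open>?h\<close> takes its first coordinate; blowing up along it leaves every rule of
        \<open>\<Sigma>\<close> valid.\<close>
      let ?h = "fst \<circ> inv e"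
      have "surj ?h"
        using e by (intro comp_surj bij_is_surj bij_imp_bij_inv range_fst)
      then have "pullback ?h I \<in> \<C>"
        using ax[OF is_structure_pullback] ax sat_dexr_pullback IJ(1) str by blast
      then show "\<exists>L\<in>\<C>. repairable_direct_product S ar I J L"
        using repairable_direct_product_pullback[OF str str e] IJ by blast
    qed
    moreover have "diagram_compatible S ar n m l \<C>"
      unfolding diagram_compatible_def
      using ax str diagram_compatible_with_sat_dexr[OF assms(3) nml] by blast
    ultimately show "critical S ar \<C> \<and> closed_under_repairable_direct_products S ar \<C> \<and>
        diagram_compatible S ar n m l \<C>" by blast
  }
  assume closure: "critical S ar \<C> \<and> closed_under_repairable_direct_products S ar \<C> \<and>
    diagram_compatible S ar n m l \<C>"
  define \<Sigma> where "\<Sigma> = {\<sigma> \<in> bounded_dexrs S ar (n + m) l. nml_dexr S ar n m l \<sigma> \<and> (\<forall>J\<in>\<C>. sat_dexr J \<sigma>)}"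
  have "I \<in> \<C>" if I: "is_structure S ar I" and sat: "\<forall>\<sigma>\<in>\<Sigma>. sat_dexr I \<sigma>" for I
  proof -
    have "\<exists>J\<in>\<C>. models J \<Delta>"
      if K: "is_structure S ar K" "substructure S ar K I" "domain K = adom K"
        "finite (domain K)" "card (domain K) \<le> n" and \<Delta>: "is_diagram S ar m l I K \<Delta>" for K \<Delta>
    proof -
      obtain G where G: "G \<subseteq> refuted_conjs S ar I K m" "finite G" "card G \<le> l"
        and \<Delta>_def: "\<Delta> = diagram m K G" using \<Delta> by (auto simp: is_diagram_def)
      have KI: "facts K \<subseteq> facts I"
      proof
        fix a assume "a \<in> facts K"
        then show "a \<in> facts I"
          using K(2) is_structureD[OF K(1)] by (cases a) (fastforce simp: substructure_def)
      qed
      obtain J v where J: "J \<in> \<C>" and v: "\<And>a. a \<in> facts K \<Longrightarrow> map_atom v a \<in> facts J"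
        and no: "\<And>\<gamma> w. \<gamma> \<in> G \<Longrightarrow> \<not> sat_conj J (case_trm v w) \<gamma>"
      proof (cases "G = {}")
        \<comment> \<open>With nothing to refute there is no rule to read off. A one-element
          critical structure satisfies every atom under the constant valuation, and the repaired
          product will again separate the elements of \<open>K\<close>.\<close>
        case True
        obtain J where J: "J \<in> \<C>" "critical_struct S ar 1 J"
          using closure by (auto simp: critical_def)
        then obtain d where d: "d \<in> domain J" unfolding critical_struct_def by fastforce
        have "sat_conj J (\<lambda>_. d) [a]" if "a \<in> facts K" for a
          using d atom_over_fact[OF K(1) that]
          by (intro critical_struct_sat_conj[OF J(2)]) auto
        then show thesis using True by (intro that[of J "\<lambda>_. d"]) (auto simp: J sat_conj_def)
      next
        case False
        show thesis
        proof (rule valuation_of_bounded_dexrs[OF assms(3) I _ str K(1) KI K(3-5) G False])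
          show "sat_dexr I \<sigma>" if "\<sigma> \<in> bounded_dexrs S ar (n + m) l" "nml_dexr S ar n m l \<sigma>"
            "\<forall>J\<in>\<C>. sat_dexr J \<sigma>" for \<sigma>
            using sat that by (simp add: \<Sigma>_def)
        qed (auto intro: that)
      qed
      \<comment> \<open>Each element of \<open>K\<close> occurs in a fact, and facts of
        \<open>K\<close> are mapped to facts of \<open>J\<close>.\<close>
      have "v ` domain K \<subseteq> domain J"
        using set_atom_facts[OF str[OF J] v] by (force simp: K(3) adom_def atom.set_map)
      then show ?thesis
        unfolding \<Delta>_def using closure G(1)
        by (intro diagram_model_of_valuation[OF assms(3,4) _ _ K(1,4) J _ v _ no])
          (auto simp: refuted_conjs_def)
    qed
    then have "diagram_compatible_with S ar n m l \<C> I"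
      unfolding diagram_compatible_with_def by blast
    then show ?thesis using closure I unfolding diagram_compatible_def by blast
  qed
  then show "finitely_axiomatizable S ar (nml_dexr S ar n m l) \<C>"
    unfolding finitely_axiomatizable_def
    using finite_bounded_dexrs[OF assms(3)]
    by (intro exI[of _ \<Sigma>]) (auto simp: \<Sigma>_def)
qed

end
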